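(* Let $\Omega$ be a slice domain in $\mathbb{H}$ and let $f:\Omega\to\mathbb{H}$ be a slice regular function. If $|f|$ has a relative minimum at $p\in\Omega$, then either $f(p)=0$ or $f$ is constant.
   Context: $\mathbb{H}$ is the real algebra of quaternions, $\mathbb{S}=\{J\in\mathbb{H}:J^2=-1\}$, $L_I=\mathbb{R}+I\mathbb{R}$ and $T_I=T\cap L_I$ for $I\in\mathbb{S}$, $T\subseteq\mathbb{H}$. A domain is a nonempty open connected set; a slice domain is a domain $\Omega\subseteq\mathbb{H}$ with $\Omega\cap\mathbb{R}\neq\emptyset$ such that $\Omega_I$ is a domain of $L_I$ for every $I\in\mathbb{S}$. A function $f:\Omega\to\mathbb{H}$ is slice regular if, for every $I\in\mathbb{S}$, the restriction $f_I$ of $f$ to $\Omega_I$ has continuous partial derivatives and $\frac12\left(\frac{\partial}{\partial x}+I\frac{\partial}{\partial y}\right)f_I(x+yI)\equiv0$. *)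

theory Defs
  imports "HOL-Analysis.Analysis"
begin

section \<open>The real algebra of quaternions\<close>

(* As for type complex, a (non-recursive) codatatype is used so that operations can be given
   componentwise by primcorec. *)
codatatype quat = Quat (q0: real) (q1: real) (q2: real) (q3: real)

lemma quat_eq_iff: "x = y \<longleftrightarrow> q0 x = q0 y \<and> q1 x = q1 y \<and> q2 x = q2 y \<and> q3 x = q3 y"
  by (auto intro: quat.expand)

lemma quat_eqI: "\<lbrakk>q0 x = q0 y; q1 x = q1 y; q2 x = q2 y; q3 x = q3 y\<rbrakk> \<Longrightarrow> x = y"
  by (simp add: quat_eq_iff)

instantiation quat :: real_vector
begin

primcorec zero_quat :: quat where
  "q0 0 = 0" | "q1 0 = 0" | "q2 0 = 0" | "q3 0 = 0"

primcorec plus_quat :: "quat \<Rightarrow> quat \<Rightarrow> quat" where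
  "q0 (x + y) = q0 x + q0 y"
| "q1 (x + y) = q1 x + q1 y"
| "q2 (x + y) = q2 x + q2 y"
| "q3 (x + y) = q3 x + q3 y"

primcorec uminus_quat :: "quat \<Rightarrow> quat" where
  "q0 (- x) = - q0 x"
| "q1 (- x) = - q1 x"
| "q2 (- x) = - q2 x"
| "q3 (- x) = - q3 x"

primcorec minus_quat :: "quat \<Rightarrow> quat \<Rightarrow> quat" where
  "q0 (x - y) = q0 x - q0 y"
| "q1 (x - y) = q1 x - q1 y"
| "q2 (x - y) = q2 x - q2 y"
| "q3 (x - y) = q3 x - q3 y"

primcorec scaleR_quat :: "real \<Rightarrow> quat \<Rightarrow> quat" where
  "q0 (scaleR r x) = r * q0 x"
| "q1 (scaleR r x) = r * q1 x"
| "q2 (scaleR r x) = r * q2 x"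
| "q3 (scaleR r x) = r * q3 x"

instance
  by standard (simp_all add: quat_eq_iff algebra_simps)

end

instantiation quat :: real_algebra_1
begin

primcorec one_quat :: quat where
  "q0 1 = 1" | "q1 1 = 0" | "q2 1 = 0" | "q3 1 = 0"

(* Hamilton's relations i^2 = j^2 = k^2 = -1, ij = k = -ji, jk = i = -kj, ki = j = -ik *)
primcorec times_quat :: "quat \<Rightarrow> quat \<Rightarrow> quat" where
  "q0 (x * y) = q0 x * q0 y - q1 x * q1 y - q2 x * q2 y - q3 x * q3 y"
| "q1 (x * y) = q0 x * q1 y + q1 x * q0 y + q2 x * q3 y - q3 x * q2 y"
| "q2 (x * y) = q0 x * q2 y - q1 x * q3 y + q2 x * q0 y + q3 x * q1 y"
| "q3 (x * y) = q0 x * q3 y + q1 x * q2 y - q2 x * q1 y + q3 x * q0 y"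

instance
  by standard (simp_all add: quat_eq_iff algebra_simps)

end

instantiation quat :: real_inner
begin

definition inner_quat :: "quat \<Rightarrow> quat \<Rightarrow> real" where
  "inner_quat x y = q0 x * q0 y + q1 x * q1 y + q2 x * q2 y + q3 x * q3 y"

definition norm_quat :: "quat \<Rightarrow> real" where
  "norm_quat x = sqrt ((q0 x)\<^sup>2 + (q1 x)\<^sup>2 + (q2 x)\<^sup>2 + (q3 x)\<^sup>2)"

definition sgn_quat :: "quat \<Rightarrow> quat" where
  "sgn_quat x = x /\<^sub>R norm x"

definition dist_quat :: "quat \<Rightarrow> quat \<Rightarrow> real" where
  "dist_quat x y = norm (x - y)"

definition uniformity_quat_def [code del]:
  "(uniformity :: (quat \<times> quat) filter) = (INF e\<in>{0 <..}. principal {(x, y). dist x y < e})"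

definition open_quat_def [code del]:
  "open (U :: quat set) \<longleftrightarrow> (\<forall>x\<in>U. eventually (\<lambda>(x', y). x' = x \<longrightarrow> y \<in> U) uniformity)"

instance
proof
  fix x y z :: quat and r :: real
  show "inner x y = inner y x"
    by (simp add: inner_quat_def mult.commute)
  show "inner (x + y) z = inner x z + inner y z"
    by (simp add: inner_quat_def algebra_simps)
  show "inner (scaleR r x) y = r * inner x y"
    by (simp add: inner_quat_def algebra_simps)
  show "0 \<le> inner x x"
    by (simp add: inner_quat_def)
  show "inner x x = 0 \<longleftrightarrow> x = 0"
    by (simp add: inner_quat_def quat_eq_iff add_nonneg_eq_0_iff)
  show "norm x = sqrt (inner x x)"
    by (simp add: inner_quat_def norm_quat_def power2_eq_square)
qed (rule sgn_quat_def dist_quat_def open_quat_def uniformity_quat_def)+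

end

lemma euler_four_square:
  fixes a b c d e f g h :: real
  shows "(a * e - b * f - c * g - d * h)\<^sup>2 + (a * f + b * e + c * h - d * g)\<^sup>2
       + (a * g - b * h + c * e + d * f)\<^sup>2 + (a * h + b * g - c * f + d * e)\<^sup>2
       = (a\<^sup>2 + b\<^sup>2 + c\<^sup>2 + d\<^sup>2) * (e\<^sup>2 + f\<^sup>2 + g\<^sup>2 + h\<^sup>2)"
  by (simp only: power2_eq_square ring_distribs mult_ac)

instantiation quat :: real_normed_div_algebra
begin

primcorec inverse_quat :: "quat \<Rightarrow> quat" where
  "q0 (inverse x) = q0 x / ((q0 x)\<^sup>2 + (q1 x)\<^sup>2 + (q2 x)\<^sup>2 + (q3 x)\<^sup>2)"
| "q1 (inverse x) = - q1 x / ((q0 x)\<^sup>2 + (q1 x)\<^sup>2 + (q2 x)\<^sup>2 + (q3 x)\<^sup>2)"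
| "q2 (inverse x) = - q2 x / ((q0 x)\<^sup>2 + (q1 x)\<^sup>2 + (q2 x)\<^sup>2 + (q3 x)\<^sup>2)"
| "q3 (inverse x) = - q3 x / ((q0 x)\<^sup>2 + (q1 x)\<^sup>2 + (q2 x)\<^sup>2 + (q3 x)\<^sup>2)"

definition divide_quat :: "quat \<Rightarrow> quat \<Rightarrow> quat" where
  "divide_quat x y = x * inverse y"

instance
proof
  fix x y :: quat
  have nz: "(q0 x)\<^sup>2 + (q1 x)\<^sup>2 + (q2 x)\<^sup>2 + (q3 x)\<^sup>2 \<noteq> 0" if "x \<noteq> 0"
    using that by (simp add: quat_eq_iff add_nonneg_eq_0_iff)
  show "inverse x * x = 1" if "x \<noteq> 0"
    using nz[OF that]
    by (simp add: quat_eq_iff power2_eq_square mult.commute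
        add_divide_distrib [symmetric] diff_divide_distrib [symmetric])
  show "x * inverse x = 1" if "x \<noteq> 0"
    using nz[OF that]
    by (simp add: quat_eq_iff power2_eq_square mult.commute
        add_divide_distrib [symmetric] diff_divide_distrib [symmetric])
  show "x div y = x * inverse y"
    by (simp add: divide_quat_def)
  show "inverse (0::quat) = 0"
    by (simp add: quat_eq_iff)
  show "norm (x * y) = norm x * norm y"
    unfolding norm_quat_def real_sqrt_mult [symmetric] times_quat.sel
    by (rule arg_cong [where f = sqrt], rule euler_four_square)
qed

end

instantiation quat :: euclidean_space
begin

definition Basis_quat_def:
  "Basis = {Quat 1 0 0 0, Quat 0 1 0 0, Quat 0 0 1 0, Quat 0 0 0 1}"

instance
  by standard (auto simp: Basis_quat_def inner_quat_def intro: quat_eqI)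

end

section \<open>Slice domains and slice regular functions\<close>

definition imag_units :: "quat set"  (\<open>\<S>\<close>) where
  "\<S> = {J. J\<^sup>2 = -1}"

definition slice_pt :: "quat \<Rightarrow> real \<Rightarrow> real \<Rightarrow> quat" where
  "slice_pt I x y = of_real x + of_real y * I"

definition slice_plane :: "quat \<Rightarrow> quat set" where
  "slice_plane I = {slice_pt I x y | x y. True}"

definition slice :: "quat set \<Rightarrow> quat \<Rightarrow> quat set" where
  "slice T I = T \<inter> slice_plane I"

definition domain_of :: "'a::topological_space set \<Rightarrow> 'a set \<Rightarrow> bool" where
  "domain_of L D \<longleftrightarrow> D \<noteq> {} \<and> openin (top_of_set L) D \<and> connected D"

definition slice_domain :: "quat set \<Rightarrow> bool" where
  "slice_domain \<Omega> \<longleftrightarrow> domain_of UNIV \<Omega> \<and> \<Omega> \<inter> \<real> \<noteq> {} \<and>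
     (\<forall>I\<in>\<S>. domain_of (slice_plane I) (slice \<Omega> I))"

definition slice_dx :: "quat \<Rightarrow> (quat \<Rightarrow> quat) \<Rightarrow> real \<Rightarrow> real \<Rightarrow> quat" where
  "slice_dx I f x y = vector_derivative (\<lambda>s. f (slice_pt I s y)) (at x)"

definition slice_dy :: "quat \<Rightarrow> (quat \<Rightarrow> quat) \<Rightarrow> real \<Rightarrow> real \<Rightarrow> quat" where
  "slice_dy I f x y = vector_derivative (\<lambda>t. f (slice_pt I x t)) (at y)"

(* The set D below is the slice of \<Omega> in the real coordinates (x, y).  In a slice domain it is open
   in the plane, so the partial derivatives only depend on the values of f on \<Omega>.  The explicit
   differentiability clauses are needed because vector_derivative is total. *)
definition slice_regular_on :: "quat set \<Rightarrow> (quat \<Rightarrow> quat) \<Rightarrow> bool" where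
  "slice_regular_on \<Omega> f \<longleftrightarrow> (\<forall>I\<in>\<S>. let D = {(x, y). slice_pt I x y \<in> \<Omega>} in
     (\<forall>(x, y)\<in>D. (\<lambda>s. f (slice_pt I s y)) differentiable (at x) \<and>
                 (\<lambda>t. f (slice_pt I x t)) differentiable (at y)) \<and>
     continuous_on D (\<lambda>(x, y). slice_dx I f x y) \<and>
     continuous_on D (\<lambda>(x, y). slice_dy I f x y) \<and>
     (\<forall>(x, y)\<in>D. (1/2) *\<^sub>R (slice_dx I f x y + I * slice_dy I f x y) = 0))"

end

theory Submission
  imports Defs "HOL-Complex_Analysis.Complex_Analysis"
begin

text \<open>
  Near \<open>p = x0 + y0 J\<close> (the case \<open>y0 = 0\<close> needs no separate treatment) the function has the form
  \<open>f (x + y M) = \<alpha> z + M * \<beta> z\<close> for \<open>z = x + i y\<close> near \<open>z0 = x0 + i y0\<close> and all imaginary units \<open>M\<close>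
  near \<open>J\<close>, where the stem \<open>(\<alpha>, \<beta>)\<close> satisfies the Cauchy--Riemann equations (\<open>local_stem\<close>).  The
  values on two slices determine such a pair; the formula then holds on the real axis, and it is
  transported to \<open>p\<close> by the identity theorem along a tube around a path that runs inside the slice
  of \<open>J\<close> from a real point to \<open>p\<close>.  No symmetry of the domain is required.

  If \<open>f p \<noteq> 0\<close>, right multiplication by a constant gives \<open>f p = 1\<close>.  The symmetrization
  \<open>s = |\<alpha>|^2 - |\<beta>|^2 + 2 i \<langle>\<alpha>, \<beta>\<rangle>\<close> is holomorphic.  It does not vanish at \<open>z0\<close>: otherwise the stem
  vanishes for some unit \<open>N\<close>, so that \<open>|\<alpha> z0 + M * \<beta> z0| = |M - N| |\<beta> z0|\<close>, which has no local
  minimum at \<open>M = J \<noteq> N\<close>.  Hence the regular reciprocal \<open>h\<close> on the slice of \<open>J\<close>, the conjugate stem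
  divided by \<open>s\<close>, exists near \<open>z0\<close>.  It satisfies \<open>h \<alpha> + J h \<beta> = 1\<close>, that is
  \<open>h * (\<alpha> + (h\<^sup>-\<^sup>1 J h) * \<beta>) = 1\<close>, and \<open>h z0 = 1\<close>.  Since \<open>h\<^sup>-\<^sup>1 J h\<close> is a unit close to \<open>J\<close>, minimality
  of \<open>|f p|\<close> says that \<open>|h|\<close> has a local maximum at \<open>z0\<close>.  By the maximum modulus principle
  \<open>h = 1\<close> near \<open>z0\<close>, so \<open>f = 1\<close> near \<open>p\<close> on the slice of \<open>J\<close> (\<open>stem_min_modulus\<close>).  The identity
  theorem spreads this over that slice, hence to the real points of the domain, and from there to
  every other slice.

  One-variable complex analysis is applied through the real linear maps \<open>cpart J v\<close>, which turn left
  multiplication by \<open>J\<close> into multiplication by \<open>i\<close>.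
\<close>

section \<open>Quaternionic conjugation and imaginary units\<close>

lemma q0_of_real [simp]: "q0 (of_real r) = r"
  and q1_of_real [simp]: "q1 (of_real r) = 0"
  and q2_of_real [simp]: "q2 (of_real r) = 0"
  and q3_of_real [simp]: "q3 (of_real r) = 0"
  by (simp_all add: of_real_def)

text \<open>
  Quaternionic conjugation.
\<close>

definition qcnj :: "quat \<Rightarrow> quat" where
  "qcnj q = Quat (q0 q) (- q1 q) (- q2 q) (- q3 q)"

lemma qcnj_sel [simp]:
  "q0 (qcnj q) = q0 q" "q1 (qcnj q) = - q1 q" "q2 (qcnj q) = - q2 q" "q3 (qcnj q) = - q3 q"
  by (simp_all add: qcnj_def)

lemma bounded_linear_qcnj: "bounded_linear qcnj"
proof (rule linear_conv_bounded_linear[THEN iffD1])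
  show "linear qcnj" by (rule linearI) (simp_all add: quat_eq_iff)
qed

lemma qcnj_mult_self: "qcnj q * q = of_real (q \<bullet> q)"
  by (simp add: quat_eq_iff inner_quat_def algebra_simps)

lemma qcnj_mult_add: "qcnj a * b + qcnj b * a = of_real (2 * (a \<bullet> b))"
  by (simp add: quat_eq_iff inner_quat_def algebra_simps del: of_real_mult of_real_add)

lemma imag_units_iff: "J \<in> \<S> \<longleftrightarrow> q0 J = 0 \<and> norm J = 1"
proof
  assume "J \<in> \<S>"
  then have sq: "J * J = -1" by (simp add: imag_units_def power2_eq_square)
  then have eqs: "(q0 J)\<^sup>2 - (q1 J)\<^sup>2 - (q2 J)\<^sup>2 - (q3 J)\<^sup>2 = -1"
    "q0 J * q1 J = 0" "q0 J * q2 J = 0" "q0 J * q3 J = 0"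
    by (auto simp: quat_eq_iff power2_eq_square)
  have "q0 J = 0"
  proof (rule ccontr)
    assume "q0 J \<noteq> 0"
    with eqs have "(q0 J)\<^sup>2 = -1" by simp
    moreover have "(q0 J)\<^sup>2 \<ge> 0" by simp
    ultimately show False by linarith
  qed
  moreover from this eqs(1) have "(q1 J)\<^sup>2 + (q2 J)\<^sup>2 + (q3 J)\<^sup>2 = 1" by simp
  ultimately show "q0 J = 0 \<and> norm J = 1" by (simp add: norm_quat_def)
next
  assume J: "q0 J = 0 \<and> norm J = 1"
  then have "(q1 J)\<^sup>2 + (q2 J)\<^sup>2 + (q3 J)\<^sup>2 = 1" by (auto simp: norm_quat_def)
  with J show "J \<in> \<S>"
    by (simp add: imag_units_def quat_eq_iff power2_eq_square)
qed

lemma imag_unit_square: "J \<in> \<S> \<Longrightarrow> J * J = -1"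
  by (simp add: imag_units_def power2_eq_square)

lemma imag_unit_square_left: "J \<in> \<S> \<Longrightarrow> J * (J * q) = - q"
  by (simp add: imag_unit_square flip: mult.assoc)

lemma imag_unit_nonzero: "J \<in> \<S> \<Longrightarrow> J \<noteq> 0"
  by (auto simp: imag_units_iff)

lemma imag_unit_conjugate:
  assumes "J \<in> \<S>" "h \<noteq> 0"
  shows "inverse h * J * h \<in> \<S>"
proof -
  have "(inverse h * J * h) * (inverse h * J * h) = inverse h * J * (h * inverse h) * J * h"
    by (simp only: mult.assoc)
  also have "\<dots> = inverse h * (J * J) * h"
    using assms by (simp add: mult.assoc)
  also have "\<dots> = -1" using assms by (simp add: imag_unit_square)
  finally show ?thesis by (simp add: imag_units_def power2_eq_square)
qed

lemma imag_unit_orthogonal_exists: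
  obtains m where "m \<in> \<S>" "m \<bullet> J = 0"
proof (cases "q1 J = 0 \<and> q2 J = 0")
  case True
  then show ?thesis
    by (intro that[of "Quat 0 1 0 0"]) (auto simp: imag_units_iff norm_quat_def inner_quat_def)
next
  case False
  define r where "r = Quat 0 (- q2 J) (q1 J) 0"
  have "r \<noteq> 0" using False by (auto simp: r_def quat_eq_iff)
  moreover have "r \<bullet> J = 0" by (simp add: r_def inner_quat_def)
  ultimately show ?thesis
    by (intro that[of "r /\<^sub>R norm r"]) (simp_all add: imag_units_iff, simp add: r_def)
qed

text \<open>
  The distance to a fixed unit has no local minimum on the sphere of imaginary units other than
  that unit itself: moving along a great circle towards it decreases the distance.
\<close>

lemma imag_unit_closer:
  assumes J: "J \<in> \<S>" and N: "N \<in> \<S>" and ne: "J \<noteq> N" and d: "d > 0"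
  obtains M where "M \<in> \<S>" "norm (M - J) < d" "norm (M - N) < norm (J - N)"
proof -
  have nJ: "q0 J = 0" "J \<bullet> J = 1" and nN: "q0 N = 0" "N \<bullet> N = 1"
    using J N by (auto simp: imag_units_iff norm_eq_1)
  define a where "a = N \<bullet> J"
  define r where "r = N - a *\<^sub>R J"
  have rJ: "r \<bullet> J = 0" by (simp add: r_def inner_diff_left a_def nJ)
  \<comment> \<open>a unit tangent direction at \<open>J\<close> towards \<open>N\<close>; any tangent direction serves when \<open>N = - J\<close>\<close>
  have "\<exists>m. m \<in> \<S> \<and> m \<bullet> J = 0 \<and> r = norm r *\<^sub>R m"
  proof (cases "r = 0")
    case True
    then show ?thesis using imag_unit_orthogonal_exists[of J] by (metis norm_zero scaleR_zero_left)
  next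
    case False
    then show ?thesis
      by (intro exI[of _ "r /\<^sub>R norm r"]) (simp add: imag_units_iff rJ, simp add: r_def nJ nN)
  qed
  then obtain m where m: "m \<in> \<S>" "m \<bullet> J = 0" "r = norm r *\<^sub>R m" by blast
  have nm: "q0 m = 0" "m \<bullet> m = 1" using m by (auto simp: imag_units_iff norm_eq_1)
  have Nm: "N = a *\<^sub>R J + norm r *\<^sub>R m" using m(3) by (simp add: r_def)
  have ab: "a\<^sup>2 + (norm r)\<^sup>2 = 1"
    using nN(2) unfolding Nm
    by (simp add: inner_add_left inner_add_right nJ nm m(2) inner_commute[of J m] power2_eq_square)
  have a1: "a \<noteq> 1"
  proof
    assume "a = 1"
    with ab have "norm r = 0" by simp
    with Nm \<open>a = 1\<close> ne show False by simp
  qed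
  define th where "th = arccos a"
  have abs: "\<bar>a\<bar> \<le> 1" using ab by (metis abs_le_square_iff abs_one one_power2 zero_le_power2 le_add_same_cancel1)
  then have a2: "-1 \<le> a" "a < 1" using a1 by auto
  have cth: "cos th = a" and th: "0 < th" "th \<le> pi"
    using a2 arccos_lt_bounded[of a] arccos_lbound[of a] arccos_ubound[of a]
      arccos_less_arccos[of a 1]
    by (auto simp: th_def)
  have sth: "sin th = norm r"
    using ab sin_ge_zero[of th] th cth sin_squared_eq[of th]
    by (metis add_diff_cancel_left' less_imp_le norm_ge_zero power2_eq_iff_nonneg)
  define M where "M t = cos t *\<^sub>R J + sin t *\<^sub>R m" for t
  have MM: "M t \<bullet> M t = 1" for t
    by (simp add: M_def inner_add_left inner_add_right nJ nm m(2) inner_commute[of J m]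
        flip: power2_eq_square)
  have MS: "M t \<in> \<S>" for t
    using MM[of t] by (simp add: imag_units_iff norm_eq_1) (simp add: M_def nJ nm)
  have MN: "M t \<bullet> N = cos (th - t)" for t
    unfolding M_def Nm
    by (simp add: inner_add_left inner_add_right nJ nm m(2) inner_commute[of J m] cos_diff cth sth)
  have "isCont M 0" unfolding M_def by (intro continuous_intros)
  then obtain e where e: "e > 0" "\<And>t. dist t 0 < e \<Longrightarrow> dist (M t) (M 0) < d"
    using d unfolding continuous_at_eps_delta by blast
  define t where "t = min (e / 2) th"
  have t: "0 < t" "t \<le> th" "t < e" using e th by (auto simp: t_def)
  have "norm (M t - J) < d"
    using e(2)[of t] t by (simp add: dist_norm M_def)
  moreover have "(norm (M t - N))\<^sup>2 < (norm (J - N))\<^sup>2"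
  proof -
    have "cos th < cos (th - t)" using t th by (intro cos_monotone_0_pi) auto
    then have "M t \<bullet> N > J \<bullet> N" using MN[of t] cth by (simp add: a_def inner_commute)
    then show ?thesis
      by (simp add: power2_norm_eq_inner inner_diff_left inner_diff_right MM nJ nN inner_commute)
  qed
  then have "norm (M t - N) < norm (J - N)" by (simp add: power2_less_imp_less)
  ultimately show ?thesis using that MS by blast
qed

section \<open>Functions that are holomorphic for a left complex structure\<close>

text \<open>
  For an imaginary unit \<open>J\<close>, the algebra embedding of the complex numbers onto the plane spanned by
  1 and \<open>J\<close>.
\<close>

definition emb :: "quat \<Rightarrow> complex \<Rightarrow> quat" where
  "emb J z = slice_pt J (Re z) (Im z)"

lemma emb_mult: "emb J z * q = Re z *\<^sub>R q + Im z *\<^sub>R (J * q)"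
  by (simp add: emb_def slice_pt_def algebra_simps of_real_def)

lemma emb_alt: "emb J z = Re z *\<^sub>R 1 + Im z *\<^sub>R J"
  using emb_mult[of J z 1] by simp

lemma emb_of_real [simp]: "emb J (of_real x) = of_real x"
  by (simp add: emb_alt of_real_def)

lemma continuous_on_emb: "continuous_on A (\<lambda>x. emb (g x) (h x))"
  if "continuous_on A g" "continuous_on A h"
  unfolding emb_alt by (intro continuous_intros that)

lemma emb_mult_emb: "J \<in> \<S> \<Longrightarrow> emb J z * emb J w = emb J (z * w)"
  by (simp add: emb_mult[of J z] emb_alt[of J] algebra_simps imag_unit_square)

text \<open>
  The function has a real derivative that is linear for left multiplication by \<open>J\<close>; \<open>a\<close> is its
  value in the direction 1.
\<close>

definition has_slice_deriv :: "quat \<Rightarrow> (complex \<Rightarrow> quat) \<Rightarrow> quat \<Rightarrow> complex \<Rightarrow> bool" where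
  "has_slice_deriv J \<phi> a z \<longleftrightarrow> (\<phi> has_derivative (\<lambda>w. emb J w * a)) (at z)"

text \<open>
  Holomorphy on \<open>W\<close> with respect to left multiplication by \<open>J\<close>.
\<close>

definition slice_hol :: "quat \<Rightarrow> (complex \<Rightarrow> quat) \<Rightarrow> complex set \<Rightarrow> bool" where
  "slice_hol J \<phi> W \<longleftrightarrow> (\<forall>z\<in>W. \<exists>a. has_slice_deriv J \<phi> a z)"

text \<open>
  The real linear map \<open>q \<mapsto> \<langle>q, v\<rangle> - i \<langle>J q, v\<rangle>\<close>.  If \<open>J * J = -1\<close>, it turns left multiplication by
  \<open>J\<close> into multiplication by \<open>i\<close>, so it sends \<open>J\<close>-holomorphic functions to holomorphic ones; the
  maps for all \<open>v\<close> together separate points.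
\<close>

definition cpart :: "quat \<Rightarrow> quat \<Rightarrow> quat \<Rightarrow> complex" where
  "cpart J v q = Complex (q \<bullet> v) (- ((J * q) \<bullet> v))"

lemma bounded_linear_cpart: "bounded_linear (cpart J v)"
proof (rule linear_conv_bounded_linear[THEN iffD1])
  show "linear (cpart J v)"
    by (rule linearI) (simp_all add: cpart_def complex_eq_iff inner_add_left distrib_left)
qed

lemma cpart_emb:
  assumes "J \<in> \<S>"
  shows "cpart J v (emb J z * q) = z * cpart J v q"
  by (simp add: cpart_def emb_mult complex_eq_iff inner_add_left distrib_left
      imag_unit_square_left[OF assms] algebra_simps)

lemma cpart_eq_imp_eq:
  assumes "\<And>v. cpart J v x = cpart J v y"
  shows "x = y"
proof -
  have "x \<bullet> v = y \<bullet> v" for v using assms[of v] by (simp add: cpart_def)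
  then show ?thesis by (metis vector_eq_rdot)
qed

lemma has_slice_deriv_cpart:
  assumes "J \<in> \<S>" "has_slice_deriv J \<phi> a z"
  shows "((\<lambda>z. cpart J v (\<phi> z)) has_field_derivative cpart J v a) (at z)"
proof -
  have "((\<lambda>z. cpart J v (\<phi> z)) has_derivative (\<lambda>w. cpart J v (emb J w * a))) (at z)"
    using assms(2) unfolding has_slice_deriv_def
    by (rule bounded_linear.has_derivative[OF bounded_linear_cpart])
  then show ?thesis
    by (simp add: cpart_emb[OF assms(1)] has_field_derivative_def mult_commute_abs)
qed

lemma slice_hol_cpart:
  assumes "J \<in> \<S>" "slice_hol J \<phi> W"
  shows "(\<lambda>z. cpart J v (\<phi> z)) holomorphic_on W"
  unfolding holomorphic_on_def field_differentiable_def
  using assms has_slice_deriv_cpart has_field_derivative_at_within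
  unfolding slice_hol_def by metis

lemma slice_hol_subset: "slice_hol J \<phi> W \<Longrightarrow> V \<subseteq> W \<Longrightarrow> slice_hol J \<phi> V"
  by (auto simp: slice_hol_def)

lemma slice_hol_diff:
  assumes "slice_hol J \<phi> W" "slice_hol J \<psi> W"
  shows "slice_hol J (\<lambda>z. \<phi> z - \<psi> z) W"
  unfolding slice_hol_def
proof
  fix z assume "z \<in> W"
  with assms obtain a b where "(\<phi> has_derivative (\<lambda>w. emb J w * a)) (at z)"
    "(\<psi> has_derivative (\<lambda>w. emb J w * b)) (at z)"
    unfolding slice_hol_def has_slice_deriv_def by meson
  then have "((\<lambda>z. \<phi> z - \<psi> z) has_derivative (\<lambda>w. emb J w * a - emb J w * b)) (at z)"
    by (rule has_derivative_diff)
  then show "\<exists>a. has_slice_deriv J (\<lambda>z. \<phi> z - \<psi> z) a z"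
    by (auto simp: has_slice_deriv_def right_diff_distrib intro!: exI[of _ "a - b"])
qed

lemma slice_hol_identity:
  assumes J: "J \<in> \<S>" and hol: "slice_hol J \<phi> W" and W: "open W" "connected W"
    and U: "U \<subseteq> W" "\<xi> \<in> W" "\<xi> islimpt U" and c: "\<And>z. z \<in> U \<Longrightarrow> \<phi> z = c" and z: "z \<in> W"
  shows "\<phi> z = c"
proof (rule cpart_eq_imp_eq)
  fix v
  have "cpart J v (\<phi> z) - cpart J v c = 0"
  proof (rule analytic_continuation[OF _ W U _ z])
    show "(\<lambda>z. cpart J v (\<phi> z) - cpart J v c) holomorphic_on W"
      by (intro holomorphic_intros slice_hol_cpart[OF J hol])
    show "\<And>z. z \<in> U \<Longrightarrow> cpart J v (\<phi> z) - cpart J v c = 0" by (simp add: c)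
  qed
  then show "cpart J v (\<phi> z) = cpart J v c" by simp
qed

text \<open>
  Maximum modulus principle.  Writing \<open>v\<close> for the value at the maximum, \<open>exp (cpart J v (\<phi> z))\<close>
  is holomorphic of modulus \<open>exp (\<phi> z \<bullet> v)\<close>, which is maximal there by the Cauchy--Schwarz
  inequality; hence \<open>\<phi> z \<bullet> v\<close> is constant, and the equality case gives \<open>\<phi> z = v\<close>.
\<close>

lemma slice_hol_maximum_modulus:
  assumes J: "J \<in> \<S>" and hol: "\<And>v. (\<lambda>z. cpart J v (\<phi> z)) holomorphic_on W"
    and W: "open W" "connected W" and w: "w \<in> W"
    and mx: "\<And>z. z \<in> W \<Longrightarrow> norm (\<phi> z) \<le> norm (\<phi> w)" and z: "z \<in> W"
  shows "\<phi> z = \<phi> w"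
proof -
  define v where "v = \<phi> w"
  define g where "g z = exp (cpart J v (\<phi> z))" for z
  have ng: "norm (g z) = exp (\<phi> z \<bullet> v)" for z by (simp add: g_def cpart_def)
  have cs: "x \<bullet> v \<le> v \<bullet> v" if "norm x \<le> norm v" for x
  proof -
    have "x \<bullet> v \<le> norm x * norm v" by (rule norm_cauchy_schwarz)
    also have "\<dots> \<le> norm v * norm v" using that by (rule mult_right_mono) simp
    finally show ?thesis by (simp add: norm_eq_sqrt_inner)
  qed
  have "g constant_on W"
  proof (rule maximum_modulus_principle[OF _ W W(1) subset_refl w])
    show "g holomorphic_on W" unfolding g_def by (intro holomorphic_intros hol)
    show "norm (g z) \<le> norm (g w)" if "z \<in> W" for z
      using cs[of "\<phi> z"] mx[OF that] by (simp add: ng v_def)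
  qed
  then have "norm (g z) = norm (g w)" using z w by (auto simp: constant_on_def)
  then have eq: "\<phi> z \<bullet> v = v \<bullet> v" by (simp add: ng v_def)
  have "norm (\<phi> z) \<le> norm v" using mx[OF z] by (simp add: v_def)
  then have "\<phi> z \<bullet> \<phi> z \<le> v \<bullet> v" by (simp add: norm_le)
  then have "(\<phi> z - v) \<bullet> (\<phi> z - v) \<le> 0"
    using eq by (simp add: inner_diff_left inner_diff_right inner_commute)
  then have "\<phi> z - v = 0" by (metis inner_ge_zero inner_eq_zero_iff order_antisym)
  then show ?thesis by (simp add: v_def)
qed

section \<open>Slice regular functions on a slice\<close>

text \<open>
  Continuity of the partial derivatives gives real differentiability, and the slice regularity
  equation says that the derivative is \<open>J\<close>-linear.
\<close>

lemma slice_regular_imp_slice_hol: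
  assumes reg: "slice_regular_on \<Omega> f" and op: "open \<Omega>" and J: "J \<in> \<S>"
  shows "slice_hol J (\<lambda>z. f (emb J z)) {z. emb J z \<in> \<Omega>}"
  unfolding slice_hol_def
proof
  fix z assume z: "z \<in> {z. emb J z \<in> \<Omega>}"
  define D where "D = {(x, y). slice_pt J x y \<in> \<Omega>}"
  define F where "F x y = f (slice_pt J x y)" for x y
  note R = reg[unfolded slice_regular_on_def Let_def, rule_format, OF J, folded D_def]
  define x where "x = Re z"
  define y where "y = Im z"
  have xyD: "(x, y) \<in> D" using z by (simp add: D_def x_def y_def emb_def)
  have "D = (\<lambda>p. slice_pt J (fst p) (snd p)) -` \<Omega>" by (auto simp: D_def)
  then have "open D"
    by (simp add: slice_pt_def) (intro continuous_open_vimage op continuous_intros)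
  then obtain A B where AB: "open A" "open B" "x \<in> A" "y \<in> B" "A \<times> B \<subseteq> D"
    using open_prod_elim[OF _ xyD] by (metis mem_Sigma_iff)
  obtain e where e: "e > 0" "ball y e \<subseteq> B" using AB openE by blast
  have box: "A \<times> ball y e \<subseteq> D" using AB e by auto
  have dx: "((\<lambda>x. F x y) has_derivative (\<lambda>t. t *\<^sub>R slice_dx J f x y)) (at x within A)"
    using R xyD unfolding F_def slice_dx_def
    by (auto simp: vector_derivative_works has_vector_derivative_def intro: has_derivative_at_withinI)
  have dy: "((\<lambda>y. F x' y) has_derivative blinfun_apply (blinfun_scaleR_left (slice_dy J f x' y')))
      (at y' within ball y e)" if "x' \<in> A" "y' \<in> ball y e" for x' y'
  proof -
    have "(x', y') \<in> D" using box that by auto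
    with R have "(\<lambda>t. f (slice_pt J x' t)) differentiable (at y')" by auto
    then have "((\<lambda>t. f (slice_pt J x' t)) has_derivative (\<lambda>t. t *\<^sub>R slice_dy J f x' y')) (at y')"
      unfolding slice_dy_def
      by (simp add: vector_derivative_works has_vector_derivative_def)
    then show ?thesis unfolding F_def
      by (auto intro: has_derivative_at_withinI simp: fun_eq_iff)
  qed
  have "continuous_on (A \<times> ball y e) (\<lambda>p. blinfun_scaleR_left (case p of (x, y) \<Rightarrow> slice_dy J f x y))"
    using R continuous_on_subset[OF _ box]
    by (intro bounded_linear.continuous_on[OF bounded_linear_blinfun_scaleR_left]) auto
  then have cont: "continuous (at (x, y) within A \<times> ball y e)
      (\<lambda>(x, y). blinfun_scaleR_left (slice_dy J f x y))"
    using AB e by (auto simp: continuous_on_eq_continuous_within case_prod_unfold)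
  have "((\<lambda>(x, y). F x y) has_derivative
      (\<lambda>(tx, ty). tx *\<^sub>R slice_dx J f x y + ty *\<^sub>R slice_dy J f x y)) (at (x, y) within A \<times> ball y e)"
    using has_derivative_partialsI[OF dx dy cont] e by simp
  moreover have "at (x, y) within A \<times> ball y e = at (x, y)"
    using AB e by (intro at_within_open) (auto intro: open_Times)
  ultimately have Fd: "((\<lambda>(x, y). F x y) has_derivative
      (\<lambda>(tx, ty). tx *\<^sub>R slice_dx J f x y + ty *\<^sub>R slice_dy J f x y)) (at (x, y))" by simp
  have RI: "((\<lambda>z. (Re z, Im z)) has_derivative (\<lambda>w. (Re w, Im w))) (at z)"
    by (intro has_derivative_Pair bounded_linear_imp_has_derivative bounded_linear_Re bounded_linear_Im)
  have "((\<lambda>z. f (emb J z)) has_derivative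
      (\<lambda>w. Re w *\<^sub>R slice_dx J f x y + Im w *\<^sub>R slice_dy J f x y)) (at z)"
    using has_derivative_compose[OF RI Fd[unfolded x_def y_def]]
    by (simp add: F_def emb_def x_def y_def)
  moreover have "slice_dy J f x y = J * slice_dx J f x y"
  proof -
    have "slice_dx J f x y + J * slice_dy J f x y = 0" using R xyD by auto
    then have "J * (slice_dx J f x y + J * slice_dy J f x y) = 0" by simp
    then show ?thesis by (simp add: distrib_left imag_unit_square_left[OF J])
  qed
  ultimately show "\<exists>a. has_slice_deriv J (\<lambda>z. f (emb J z)) a z"
    unfolding has_slice_deriv_def emb_mult by auto
qed


section \<open>Stem functions\<close>

text \<open>
  Quaternion-valued pairs subject to the Cauchy--Riemann equations, with \<open>A\<close> and \<open>B\<close> the partial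
  derivatives in the real direction: \<open>\<alpha> + i \<beta>\<close> is holomorphic with values in the complexified
  quaternions.  No parity in the imaginary part of \<open>z\<close> is imposed.
\<close>

definition stem_on :: "(complex \<Rightarrow> quat) \<Rightarrow> (complex \<Rightarrow> quat) \<Rightarrow> complex set \<Rightarrow> bool" where
  "stem_on \<alpha> \<beta> W \<longleftrightarrow> (\<forall>z\<in>W. \<exists>A B.
     (\<alpha> has_derivative (\<lambda>w. Re w *\<^sub>R A - Im w *\<^sub>R B)) (at z) \<and>
     (\<beta> has_derivative (\<lambda>w. Re w *\<^sub>R B + Im w *\<^sub>R A)) (at z))"

lemma stem_on_subset: "stem_on \<alpha> \<beta> W \<Longrightarrow> V \<subseteq> W \<Longrightarrow> stem_on \<alpha> \<beta> V"
  by (auto simp: stem_on_def)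

lemma stem_on_bounded_linear:
  assumes "stem_on \<alpha> \<beta> W" "bounded_linear L"
  shows "stem_on (\<lambda>z. L (\<alpha> z)) (\<lambda>z. L (\<beta> z)) W"
  unfolding stem_on_def
proof
  interpret L: bounded_linear L by fact
  fix z assume "z \<in> W"
  with assms(1) obtain A B where
    "(\<alpha> has_derivative (\<lambda>w. Re w *\<^sub>R A - Im w *\<^sub>R B)) (at z)"
    "(\<beta> has_derivative (\<lambda>w. Re w *\<^sub>R B + Im w *\<^sub>R A)) (at z)"
    unfolding stem_on_def by blast
  from this[THEN L.has_derivative] have "((\<lambda>z. L (\<alpha> z)) has_derivative (\<lambda>w. Re w *\<^sub>R L A - Im w *\<^sub>R L B)) (at z)"
    "((\<lambda>z. L (\<beta> z)) has_derivative (\<lambda>w. Re w *\<^sub>R L B + Im w *\<^sub>R L A)) (at z)"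
    by (simp_all add: L.add L.diff L.scaleR)
  then show "\<exists>A B. ((\<lambda>z. L (\<alpha> z)) has_derivative (\<lambda>w. Re w *\<^sub>R A - Im w *\<^sub>R B)) (at z) \<and>
      ((\<lambda>z. L (\<beta> z)) has_derivative (\<lambda>w. Re w *\<^sub>R B + Im w *\<^sub>R A)) (at z)"
    by blast
qed

lemma stem_on_continuous:
  assumes "stem_on \<alpha> \<beta> W" "z \<in> W"
  shows "isCont \<alpha> z" "isCont \<beta> z"
  using assms has_derivative_continuous unfolding stem_on_def by blast+

lemma stem_on_imp_slice_hol:
  assumes "stem_on \<alpha> \<beta> W" "J \<in> \<S>"
  shows "slice_hol J (\<lambda>z. \<alpha> z + J * \<beta> z) W"
  unfolding slice_hol_def has_slice_deriv_def
proof
  fix z assume "z \<in> W"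
  with assms(1) obtain A B where AB:
    "(\<alpha> has_derivative (\<lambda>w. Re w *\<^sub>R A - Im w *\<^sub>R B)) (at z)"
    "(\<beta> has_derivative (\<lambda>w. Re w *\<^sub>R B + Im w *\<^sub>R A)) (at z)"
    unfolding stem_on_def by blast
  have "((\<lambda>z. \<alpha> z + J * \<beta> z) has_derivative (\<lambda>w. emb J w * (A + J * B))) (at z)"
    by (rule has_derivative_eq_rhs, (rule derivative_intros AB)+)
      (simp add: fun_eq_iff emb_mult algebra_simps imag_unit_square_left[OF assms(2)])
  then show "\<exists>a. ((\<lambda>z. \<alpha> z + J * \<beta> z) has_derivative (\<lambda>w. emb J w * a)) (at z)" ..
qed

text \<open>
  Solving \<open>\<alpha> + J \<beta> = \<phi>\<close> and \<open>\<alpha> + K \<beta> = \<psi>\<close> for two holomorphic functions on different slices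
  produces a stem.
\<close>

lemma slice_hol_imp_stem_on:
  assumes J: "J \<in> \<S>" and K: "K \<in> \<S>" and ne: "J \<noteq> K"
    and \<phi>: "slice_hol J \<phi> W" and \<psi>: "slice_hol K \<psi> W"
  shows "stem_on (\<lambda>z. \<phi> z - J * (inverse (J - K) * (\<phi> z - \<psi> z)))
    (\<lambda>z. inverse (J - K) * (\<phi> z - \<psi> z)) W"
  unfolding stem_on_def
proof
  fix z assume z: "z \<in> W"
  obtain a where a: "(\<phi> has_derivative (\<lambda>w. emb J w * a)) (at z)"
    using \<phi> z unfolding slice_hol_def has_slice_deriv_def by blast
  obtain b where b: "(\<psi> has_derivative (\<lambda>w. emb K w * b)) (at z)"
    using \<psi> z unfolding slice_hol_def has_slice_deriv_def by blast
  define c where "c = inverse (J - K)"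
  have c: "c * ((J - K) * q) = q" "(J - K) * (c * q) = q" for q
    using ne by (simp_all add: c_def flip: mult.assoc)
  define B where "B = c * (a - b)"
  define A where "A = a - J * B"
  have "(J - K) * A = J * a - K * b"
  proof -
    have "(J - K) * B = a - b" by (simp add: B_def c)
    then have "K * ((J - K) * B) = K * (a - b)" by simp
    then have "K * (J * B) + B = K * (a - b)"
      by (simp add: algebra_simps imag_unit_square_left K)
    then show ?thesis
      by (simp add: A_def algebra_simps imag_unit_square_left J)
  qed
  then have A: "c * (J * a - K * b) = A" using c(1)[of A] by simp
  have JA: "J * a - J * A = - B"
    by (simp add: A_def algebra_simps imag_unit_square_left J)
  have "(\<lambda>w. c * (emb J w * a - emb K w * b)) = (\<lambda>w. Re w *\<^sub>R B + Im w *\<^sub>R A)"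
    unfolding A[symmetric] B_def by (simp add: fun_eq_iff emb_mult algebra_simps)
  then have dB: "((\<lambda>z. c * (\<phi> z - \<psi> z)) has_derivative (\<lambda>w. Re w *\<^sub>R B + Im w *\<^sub>R A)) (at z)"
    using has_derivative_mult_right[OF has_derivative_diff[OF a b], of c] by simp
  have "(\<lambda>w. emb J w * a - J * (Re w *\<^sub>R B + Im w *\<^sub>R A)) = (\<lambda>w. Re w *\<^sub>R A + Im w *\<^sub>R (J * a - J * A))"
    by (simp add: fun_eq_iff emb_mult A_def algebra_simps)
  then have "((\<lambda>z. \<phi> z - J * (c * (\<phi> z - \<psi> z))) has_derivative
      (\<lambda>w. Re w *\<^sub>R A - Im w *\<^sub>R B)) (at z)"
    using has_derivative_diff[OF a has_derivative_mult_right[OF dB, of J]] by (simp add: JA)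
  with dB show "\<exists>A B. ((\<lambda>z. \<phi> z - J * (inverse (J - K) * (\<phi> z - \<psi> z))) has_derivative
        (\<lambda>w. Re w *\<^sub>R A - Im w *\<^sub>R B)) (at z) \<and>
      ((\<lambda>z. inverse (J - K) * (\<phi> z - \<psi> z)) has_derivative (\<lambda>w. Re w *\<^sub>R B + Im w *\<^sub>R A)) (at z)"
    unfolding c_def by blast
qed

section \<open>The symmetrization and the regular reciprocal\<close>

text \<open>
  The symmetrization: the product of \<open>a + i b\<close> and its quaternionic conjugate in the complexified
  quaternions, which is a complex number.
\<close>

definition stem_norm :: "quat \<Rightarrow> quat \<Rightarrow> complex" where
  "stem_norm a b = Complex (a \<bullet> a - b \<bullet> b) (2 * (a \<bullet> b))"

text \<open>
  The value on the slice of \<open>J\<close> of the inverse of \<open>a + i b\<close> in the complexified quaternions, namely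
  the conjugate divided by the symmetrization.
\<close>

definition stem_inv :: "quat \<Rightarrow> quat \<Rightarrow> quat \<Rightarrow> quat" where
  "stem_inv J a b = emb J (inverse (stem_norm a b)) * (qcnj a + J * qcnj b)"

lemma emb_commute: "J * emb J z = emb J z * J"
  by (simp add: emb_alt algebra_simps)

lemma qcnj_mult_stem_norm:
  assumes J: "J \<in> \<S>"
  shows "(qcnj a + J * qcnj b) * a + J * ((qcnj a + J * qcnj b) * b) = emb J (stem_norm a b)"
proof -
  have "(qcnj a + J * qcnj b) * a + J * ((qcnj a + J * qcnj b) * b)
      = qcnj a * a - qcnj b * b + J * (qcnj a * b + qcnj b * a)"
    by (simp add: algebra_simps imag_unit_square_left[OF J])
  also have "\<dots> = emb J (stem_norm a b)"
    unfolding qcnj_mult_self qcnj_mult_add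
    by (simp add: emb_alt stem_norm_def of_real_def algebra_simps)
  finally show ?thesis .
qed

lemma stem_inv_mult:
  assumes J: "J \<in> \<S>" and "stem_norm a b \<noteq> 0"
  shows "stem_inv J a b * a + J * (stem_inv J a b * b) = 1"
proof -
  define k where "k = qcnj a + J * qcnj b"
  define e where "e = emb J (inverse (stem_norm a b))"
  have "stem_inv J a b * a + J * (stem_inv J a b * b) = e * (k * a) + (J * e) * (k * b)"
    by (simp add: stem_inv_def k_def e_def mult.assoc)
  also have "\<dots> = e * (k * a + J * (k * b))"
    unfolding e_def emb_commute by (simp add: algebra_simps)
  also have "\<dots> = e * emb J (stem_norm a b)"
    unfolding k_def qcnj_mult_stem_norm[OF J] ..
  also have "\<dots> = 1"
    using assms(2) emb_of_real[of J 1] by (simp add: e_def emb_mult_emb[OF J])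
  finally show ?thesis .
qed

lemma stem_inv_eq_1:
  assumes J: "J \<in> \<S>" and s: "stem_norm a b \<noteq> 0" and ab: "a + J * b = 1"
  shows "stem_inv J a b = 1"
proof -
  have a: "a = 1 - J * b" using ab by (simp add: eq_diff_eq)
  have q0J: "q0 J = 0" using J by (simp add: imag_units_iff)
  define k where "k = qcnj a + J * qcnj b"
  have "qcnj a = 1 + qcnj b * J"
    unfolding a by (simp add: quat_eq_iff q0J algebra_simps)
  then have "J * k = k * J"
    by (simp add: k_def algebra_simps imag_unit_square_left[OF J] imag_unit_square[OF J])
  then have "k = k * a + J * (k * b)" unfolding a by (simp add: algebra_simps flip: mult.assoc)
  also have "\<dots> = emb J (stem_norm a b)" unfolding k_def by (rule qcnj_mult_stem_norm[OF J])
  finally show ?thesis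
    using s emb_of_real[of J 1] by (simp add: stem_inv_def k_def emb_mult_emb[OF J])
qed

text \<open>
  A zero of the symmetrization comes from a zero on the corresponding sphere of quaternions.
\<close>

lemma stem_norm_eq_0_imp_zero:
  assumes "stem_norm a b = 0" "b \<noteq> 0"
  obtains N where "N \<in> \<S>" "a + N * b = 0"
proof
  \<comment> \<open>the imaginary part of \<open>stem_norm\<close> makes \<open>N\<close> purely imaginary, the real part makes its norm 1\<close>
  define N where "N = - (a * inverse b)"
  have ab: "a \<bullet> a = b \<bullet> b" "a \<bullet> b = 0" using assms(1) by (auto simp: stem_norm_def complex_eq_iff)
  have "norm a = norm b" using ab by (simp add: norm_eq_sqrt_inner)
  then have "norm N = 1" using assms(2) by (simp add: N_def norm_mult norm_inverse)
  moreover have "q0 N = - (a \<bullet> b) / (b \<bullet> b)"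
    by (simp add: N_def inner_quat_def power2_eq_square add_divide_distrib
        diff_divide_distrib)
  ultimately show "N \<in> \<S>" by (simp add: imag_units_iff ab)
  show "a + N * b = 0" using assms(2) by (simp add: N_def mult.assoc)
qed

lemma stem_norm_holomorphic:
  assumes "stem_on \<alpha> \<beta> W"
  shows "(\<lambda>z. stem_norm (\<alpha> z) (\<beta> z)) holomorphic_on W"
  unfolding holomorphic_on_def field_differentiable_def
proof
  fix z assume "z \<in> W"
  with assms obtain A B where AB:
    "(\<alpha> has_derivative (\<lambda>w. Re w *\<^sub>R A - Im w *\<^sub>R B)) (at z)"
    "(\<beta> has_derivative (\<lambda>w. Re w *\<^sub>R B + Im w *\<^sub>R A)) (at z)"
    unfolding stem_on_def by blast
  define P where "P = Complex (2 * (\<alpha> z \<bullet> A) - 2 * (\<beta> z \<bullet> B)) (2 * (A \<bullet> \<beta> z + \<alpha> z \<bullet> B))"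
  have eq: "stem_norm a b = (a \<bullet> a - b \<bullet> b) *\<^sub>R 1 + (2 * (a \<bullet> b)) *\<^sub>R \<i>" for a b
    by (simp add: stem_norm_def complex_eq_iff)
  have "((\<lambda>z. stem_norm (\<alpha> z) (\<beta> z)) has_derivative (\<lambda>w. P * w)) (at z)"
    unfolding eq
    by (rule has_derivative_eq_rhs, (rule derivative_intros AB)+)
      (simp add: fun_eq_iff complex_eq_iff P_def inner_add_left inner_add_right inner_diff_left
        inner_diff_right inner_commute algebra_simps)
  then show "\<exists>P. ((\<lambda>z. stem_norm (\<alpha> z) (\<beta> z)) has_field_derivative P) (at z within W)"
    by (auto simp: has_field_derivative_def intro: has_derivative_at_withinI)
qed

lemma cpart_stem_inv_holomorphic:
  assumes J: "J \<in> \<S>" and st: "stem_on \<alpha> \<beta> W" and nz: "\<And>z. z \<in> W \<Longrightarrow> stem_norm (\<alpha> z) (\<beta> z) \<noteq> 0"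
  shows "(\<lambda>z. cpart J v (stem_inv J (\<alpha> z) (\<beta> z))) holomorphic_on W"
proof -
  have "slice_hol J (\<lambda>z. qcnj (\<alpha> z) + J * qcnj (\<beta> z)) W"
    by (intro stem_on_imp_slice_hol stem_on_bounded_linear[OF st] bounded_linear_qcnj J)
  then show ?thesis
    unfolding stem_inv_def cpart_emb[OF J]
    by (intro holomorphic_intros stem_norm_holomorphic st slice_hol_cpart[OF J]) (use nz in auto)
qed

lemma isCont_stem_inv:
  assumes "isCont \<alpha> z" "isCont \<beta> z" "stem_norm (\<alpha> z) (\<beta> z) \<noteq> 0"
  shows "isCont (\<lambda>z. stem_inv J (\<alpha> z) (\<beta> z)) z"
proof -
  have s: "isCont (\<lambda>z. stem_norm (\<alpha> z) (\<beta> z)) z"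
    unfolding stem_norm_def Complex_eq by (intro continuous_intros assms)
  show ?thesis
    unfolding stem_inv_def emb_alt
    by (intro continuous_intros continuous_at_within_inverse s assms
        bounded_linear.continuous[OF bounded_linear_qcnj]
        bounded_linear.continuous[OF bounded_linear_Re]
        bounded_linear.continuous[OF bounded_linear_Im])
qed

section \<open>The minimum modulus principle on a slice\<close>

text \<open>
  The normalized local form of the minimum modulus principle; minimality is assumed for all nearby
  units \<open>M\<close>, not just on the slice of \<open>J\<close>, on which it would not suffice.
\<close>

lemma stem_min_modulus:
  assumes J: "J \<in> \<S>" and e: "\<epsilon> > 0" and st: "stem_on \<alpha> \<beta> (ball z0 \<epsilon>)"
    and one: "\<alpha> z0 + J * \<beta> z0 = 1"
    and mn: "\<And>z M. z \<in> ball z0 \<epsilon> \<Longrightarrow> M \<in> \<S> \<Longrightarrow> norm (M - J) < \<epsilon> \<Longrightarrow> 1 \<le> norm (\<alpha> z + M * \<beta> z)"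
  obtains d where "d > 0" "d \<le> \<epsilon>" "\<And>z. z \<in> ball z0 d \<Longrightarrow> \<alpha> z + J * \<beta> z = 1"
proof -
  define s where "s z = stem_norm (\<alpha> z) (\<beta> z)" for z
  define h where "h z = stem_inv J (\<alpha> z) (\<beta> z)" for z
  have z0: "z0 \<in> ball z0 \<epsilon>" using e by simp
  have s0: "s z0 \<noteq> 0"
  proof
    assume s: "s z0 = 0"
    have "\<beta> z0 \<noteq> 0"
      using s one by (auto simp: s_def stem_norm_def complex_eq_iff)
    then obtain N where N: "N \<in> \<S>" "\<alpha> z0 + N * \<beta> z0 = 0"
      using s stem_norm_eq_0_imp_zero unfolding s_def by blast
    have val: "\<alpha> z0 + M * \<beta> z0 = (M - N) * \<beta> z0" for M
      using N(2) by (simp add: algebra_simps eq_neg_iff_add_eq_0[symmetric])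
    have "J \<noteq> N" using N one by auto
    then obtain M where M: "M \<in> \<S>" "norm (M - J) < \<epsilon>" "norm (M - N) < norm (J - N)"
      using imag_unit_closer[OF J N(1) _ e] by blast
    have "norm (\<alpha> z0 + M * \<beta> z0) < norm (\<alpha> z0 + J * \<beta> z0)"
      unfolding val norm_mult using M(3) \<open>\<beta> z0 \<noteq> 0\<close> by (intro mult_strict_right_mono) auto
    then show False using mn[OF z0 M(1,2)] one by simp
  qed
  have cont: "isCont \<alpha> z0" "isCont \<beta> z0" using stem_on_continuous[OF st z0] by auto
  have ch: "isCont h z0"
    unfolding h_def by (rule isCont_stem_inv) (use cont s0 s_def in auto)
  have h0: "h z0 = 1"
    unfolding h_def by (rule stem_inv_eq_1[OF J _ one]) (use s0 s_def in auto)
  \<comment> \<open>the unit at which the value of the stem is the inverse of \<open>h z\<close>\<close>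
  define T where "T z = inverse (h z) * J * h z" for z
  have "isCont T z0" unfolding T_def using h0 by (intro continuous_intros ch) auto
  then obtain d1 where d1: "d1 > 0" "\<And>z. dist z z0 < d1 \<Longrightarrow> norm (T z - J) < \<epsilon>"
    using e h0 unfolding continuous_at_eps_delta by (fastforce simp: T_def dist_norm)
  have "isCont s z0"
    unfolding s_def stem_norm_def Complex_eq by (intro continuous_intros cont)
  then obtain d2 where d2: "d2 > 0" "\<And>z. dist z0 z < d2 \<Longrightarrow> s z \<noteq> 0"
    using continuous_at_avoid[of z0 s 0] s0 by blast
  define d where "d = min \<epsilon> (min d1 d2)"
  have d: "d > 0" "d \<le> \<epsilon>" using e d1 d2 by (auto simp: d_def)
  have sub: "ball z0 d \<subseteq> ball z0 \<epsilon>" using d by auto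
  have eq: "h z * \<alpha> z + J * (h z * \<beta> z) = 1" if "z \<in> ball z0 d" for z
    unfolding h_def by (rule stem_inv_mult[OF J]) (use that d2 in \<open>auto simp: d_def s_def\<close>)
  have h_le: "norm (h z) \<le> norm (h z0)" if z: "z \<in> ball z0 d" for z
  proof -
    have nz: "h z \<noteq> 0" using eq[OF z] by auto
    have "h z * (\<alpha> z + T z * \<beta> z) = h z * \<alpha> z + (h z * inverse (h z)) * J * h z * \<beta> z"
      by (simp only: T_def distrib_left mult.assoc)
    also have "\<dots> = 1" using eq[OF z] nz by (simp add: mult.assoc)
    finally have "norm (h z) * norm (\<alpha> z + T z * \<beta> z) = 1" by (metis norm_mult norm_one)
    moreover have "1 \<le> norm (\<alpha> z + T z * \<beta> z)"
      using z sub d1(2)[of z] imag_unit_conjugate[OF J nz]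
      by (intro mn) (auto simp: T_def d_def dist_commute)
    ultimately show ?thesis
      using mult_left_mono[of 1 "norm (\<alpha> z + T z * \<beta> z)" "norm (h z)"] by (simp add: h0)
  qed
  have holo: "(\<lambda>z. cpart J v (h z)) holomorphic_on ball z0 d" for v
    unfolding h_def
    by (rule cpart_stem_inv_holomorphic[OF J stem_on_subset[OF st sub]])
      (use d2 in \<open>auto simp: d_def s_def\<close>)
  have h1: "h z = 1" if "z \<in> ball z0 d" for z
    using slice_hol_maximum_modulus[OF J holo open_ball connected_ball _ h_le that] d h0 by simp
  have "\<alpha> z + J * \<beta> z = 1" if "z \<in> ball z0 d" for z
    using eq[OF that] h1[OF that] by simp
  then show ?thesis by (rule that[OF d])
qed


section \<open>Slice domains\<close>

lemma quat_in_some_slice: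
  obtains J z where "J \<in> \<S>" "q = emb J z"
proof -
  define v where "v = q - of_real (q0 q)"
  have "\<exists>J\<in>\<S>. v = norm v *\<^sub>R J"
  proof (cases "v = 0")
    case True
    then show ?thesis by (intro bexI[of _ "Quat 0 1 0 0"]) (auto simp: imag_units_iff norm_quat_def)
  next
    case False
    then show ?thesis
      by (intro bexI[of _ "v /\<^sub>R norm v"]) (simp_all add: imag_units_iff, simp add: v_def)
  qed
  then obtain J where J: "J \<in> \<S>" "v = norm v *\<^sub>R J" by blast
  then have "q = emb J (Complex (q0 q) (norm v))"
    by (simp add: emb_alt v_def of_real_def algebra_simps)
  with J show ?thesis using that by blast
qed

lemma open_emb_vimage: "open \<Omega> \<Longrightarrow> open {z. emb J z \<in> \<Omega>}"
  using open_vimage[of \<Omega> "emb J"] continuous_on_emb[of UNIV "\<lambda>_. J" "\<lambda>z. z"]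
  by (simp add: vimage_def)

text \<open>
  The slice as a set of quaternions and its coordinate domain in the complex plane are homeomorphic.
\<close>

lemma connected_emb_vimage:
  assumes J: "J \<in> \<S>" and con: "connected (slice \<Omega> J)"
  shows "connected {z. emb J z \<in> \<Omega>}"
proof -
  define c where "c q = Complex (q \<bullet> 1) (q \<bullet> J)" for q
  have J1: "q0 J = 0" "J \<bullet> J = 1" using J by (auto simp: imag_units_iff norm_eq_1)
  have c: "c (emb J z) = z" for z
    by (simp add: c_def emb_alt inner_add_left J1 complex_eq_iff)
      (simp add: inner_quat_def J1)
  have mem: "emb J z \<in> slice_plane J" for z by (auto simp: slice_plane_def emb_def)
  have ex: "\<exists>z. q = emb J z" if q: "q \<in> slice_plane J" for q
  proof -
    obtain x y where "q = slice_pt J x y" using q by (auto simp: slice_plane_def)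
    then show ?thesis by (intro exI[of _ "Complex x y"]) (simp add: emb_def)
  qed
  have "{z. emb J z \<in> \<Omega>} = c ` slice \<Omega> J"
  proof safe
    fix z assume "emb J z \<in> \<Omega>"
    then show "z \<in> c ` slice \<Omega> J"
      using mem[of z] by (intro image_eqI[of _ _ "emb J z"]) (auto simp: c slice_def)
  next
    fix q assume "q \<in> slice \<Omega> J"
    then show "emb J (c q) \<in> \<Omega>" using ex[of q] by (auto simp: slice_def c)
  qed
  moreover have "continuous_on (slice \<Omega> J) c"
    unfolding c_def Complex_eq by (intro continuous_intros)
  ultimately show ?thesis using con connected_continuous_image by metis
qed

lemma islimpt_real_line:
  assumes "open W" "complex_of_real r \<in> W"
  shows "complex_of_real r islimpt (W \<inter> \<real>)"
  unfolding islimpt_approachable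
proof (intro allI impI)
  fix e :: real assume "e > 0"
  obtain d where d: "d > 0" "ball (complex_of_real r) d \<subseteq> W" using assms openE by blast
  define t where "t = min d e / 2"
  have t: "t > 0" "t < d" "t < e" using d \<open>e > 0\<close> by (auto simp: t_def)
  have dt: "dist (complex_of_real (r + t)) (of_real r) = t"
    using t by (simp add: dist_norm)
  then have "complex_of_real (r + t) \<in> W" using d t by (auto simp: dist_commute)
  then show "\<exists>x'\<in>W \<inter> \<real>. x' \<noteq> complex_of_real r \<and> dist x' (complex_of_real r) < e"
    using t dt by (intro bexI[of _ "complex_of_real (r + t)"]) (auto simp del: of_real_add)
qed

lemma slice_hol_real_identity:
  assumes J: "J \<in> \<S>" and hol: "slice_hol J \<phi> W" and W: "open W" "connected W"
    and r: "of_real r \<in> W" and c: "\<And>x. of_real x \<in> W \<Longrightarrow> \<phi> (of_real x) = c" and z: "z \<in> W"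
  shows "\<phi> z = c"
  by (rule slice_hol_identity[OF J hol W _ r islimpt_real_line[OF W(1) r] _ z])
    (auto elim!: Reals_cases intro: c)

text \<open>
  The local representation formula.  It is available at every point of a slice domain, although a
  global stem need not exist on a domain that is not axially symmetric.
\<close>

lemma local_stem:
  assumes sd: "slice_domain \<Omega>" and reg: "slice_regular_on \<Omega> f"
    and J: "J \<in> \<S>" and p: "emb J z0 \<in> \<Omega>"
  obtains \<alpha> \<beta> d where "d > 0" "stem_on \<alpha> \<beta> (ball z0 d)"
    "\<And>z M. z \<in> ball z0 d \<Longrightarrow> M \<in> \<S> \<Longrightarrow> norm (M - J) < d \<Longrightarrow>
       emb M z \<in> \<Omega> \<and> f (emb M z) = \<alpha> z + M * \<beta> z"
proof -
  have op: "open \<Omega>" using sd by (simp add: slice_domain_def domain_of_def)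
  obtain r where r: "of_real r \<in> \<Omega>"
    using sd by (auto simp: slice_domain_def elim!: Reals_cases)
  have con: "connected {z. emb J z \<in> \<Omega>}"
    using connected_emb_vimage[OF J] sd J by (auto simp: slice_domain_def domain_of_def)
  have "path_connected {z. emb J z \<in> \<Omega>}"
    by (rule connected_open_path_connected[OF open_emb_vimage[OF op] con])
  then obtain g where g: "path g" "path_image g \<subseteq> {z. emb J z \<in> \<Omega>}"
    "pathstart g = of_real r" "pathfinish g = z0"
    using r p unfolding path_connected_def by (metis emb_of_real mem_Collect_eq)
  define V where "V = {x. emb (fst x) (snd x) \<in> \<Omega>}"
  have "open V"
    unfolding V_def
    using open_vimage[OF op continuous_on_emb[of UNIV fst snd]]
    by (simp add: vimage_def continuous_on_fst continuous_on_snd)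
  moreover have "compact ({J} \<times> path_image g)"
    using g by (intro compact_Times compact_path_image) auto
  moreover have "{J} \<times> path_image g \<subseteq> V" using g by (auto simp: V_def)
  ultimately obtain e where e: "e > 0" "(\<Union>x\<in>{J} \<times> path_image g. ball x e) \<subseteq> V"
    using compact_subset_open_imp_ball_epsilon_subset by metis
  define d where "d = e / 2"
  have d: "d > 0" using e by (simp add: d_def)
  \<comment> \<open>the tube around the path, as a sum of connected sets; it has a real point and contains \<open>z0\<close>\<close>
  define W where "W = (\<Union>x\<in>path_image g. \<Union>y\<in>ball 0 d. {x + y})"
  have Wmem: "z \<in> W" if "x \<in> path_image g" "dist x z < d" for x z
    unfolding W_def using that
    by (intro UN_I[of x] UN_I[of "z - x"]) (auto simp: dist_norm norm_minus_commute)
  have W_ball: "W = (\<Union>x\<in>path_image g. ball x d)"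
  proof safe
    fix z assume "z \<in> W"
    then obtain x y where "x \<in> path_image g" "norm y < d" "z = x + y" by (auto simp: W_def)
    then show "z \<in> (\<Union>x\<in>path_image g. ball x d)" by (intro UN_I[of x]) (auto simp: dist_norm)
  next
    fix x z assume "x \<in> path_image g" "z \<in> ball x d"
    then show "z \<in> W" by (auto intro: Wmem)
  qed
  have W: "open W" "connected W"
  proof -
    show "open W" unfolding W_ball by auto
    have "W = (\<lambda>(x, y). x + y) ` (path_image g \<times> ball 0 d)" by (auto simp: W_def)
    moreover have "continuous_on (path_image g \<times> ball 0 d) (\<lambda>(x, y). x + y)"
      unfolding case_prod_unfold by (intro continuous_intros)
    ultimately show "connected W"
      using g by (auto intro!: connected_continuous_image connected_Times connected_path_image)
  qed
  have WO: "emb M z \<in> \<Omega>" if "z \<in> W" "norm (M - J) < d" for z M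
  proof -
    obtain x where x: "x \<in> path_image g" "dist x z < d"
      using \<open>z \<in> W\<close> by (auto simp: W_ball)
    have "dist (J, x) (M, z) \<le> dist J M + dist x z"
      by (simp add: dist_Pair_Pair sqrt_sum_squares_le_sum)
    also have "\<dots> < e" using x that by (simp add: d_def dist_norm norm_minus_commute)
    finally have "(M, z) \<in> ball (J, x) e" by simp
    then have "(M, z) \<in> V" using e(2) x(1) by blast
    then show ?thesis by (simp add: V_def)
  qed
  have rW: "of_real r \<in> W" using Wmem[of "of_real r"] d g pathstart_in_path_image by force
  have hol: "slice_hol M (\<lambda>z. f (emb M z)) W" if "M \<in> \<S>" "norm (M - J) < d" for M
    by (rule slice_hol_subset[OF slice_regular_imp_slice_hol[OF reg op that(1)]])
      (use WO that in auto)
  have JJ: "J \<noteq> - J" using imag_unit_nonzero[OF J] by (simp add: quat_eq_iff)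
  have "- J \<in> \<S>" using J by (simp add: imag_units_iff)
  \<comment> \<open>a second unit close to \<open>J\<close>, found by moving from \<open>J\<close> towards \<open>- J\<close>\<close>
  then obtain K where K: "K \<in> \<S>" "norm (K - J) < d" "norm (K - - J) < norm (J - - J)"
    using imag_unit_closer[OF J _ JJ d] by blast
  then have JK: "J \<noteq> K" by auto
  define \<beta> where "\<beta> z = inverse (J - K) * (f (emb J z) - f (emb K z))" for z
  define \<alpha> where "\<alpha> z = f (emb J z) - J * \<beta> z" for z
  have st: "stem_on \<alpha> \<beta> W"
    unfolding \<alpha>_def \<beta>_def by (rule slice_hol_imp_stem_on[OF J K(1) JK hol hol]) (use J K d in auto)
  have rep: "f (emb M z) = \<alpha> z + M * \<beta> z" if "M \<in> \<S>" "norm (M - J) < d" "z \<in> W" for M z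
  proof -
    have "f (emb M z) - (\<alpha> z + M * \<beta> z) = 0"
      by (rule slice_hol_real_identity[OF that(1)
            slice_hol_diff[OF hol[OF that(1,2)] stem_on_imp_slice_hol[OF st that(1)]] W rW _ that(3)])
        (simp add: \<alpha>_def \<beta>_def)
    then show ?thesis by simp
  qed
  have sub: "ball z0 d \<subseteq> W" using Wmem g pathfinish_in_path_image by force
  show ?thesis
    by (rule that[OF d stem_on_subset[OF st sub]]) (use WO rep sub in auto)
qed

theorem theorem10p2:
  fixes \<Omega> :: "quat set" and f :: "quat \<Rightarrow> quat" and p :: quat
  assumes "slice_domain \<Omega>"
    and "slice_regular_on \<Omega> f"
    and "p \<in> \<Omega>"
    and "\<forall>\<^sub>F q in at p within \<Omega>. norm (f p) \<le> norm (f q)"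
  shows "f p = 0 \<or> f constant_on \<Omega>"
proof (cases "f p = 0")
  case False
  then have fp: "f p \<noteq> 0" .
  note sd = assms(1) and reg = assms(2)
  have op: "open \<Omega>" using sd by (simp add: slice_domain_def domain_of_def)
  have con: "connected {z. emb M z \<in> \<Omega>}" if "M \<in> \<S>" for M
    using connected_emb_vimage[OF that] sd that by (auto simp: slice_domain_def domain_of_def)
  note hol = slice_regular_imp_slice_hol[OF reg op]
  obtain J z0 where J: "J \<in> \<S>" and p: "p = emb J z0" by (rule quat_in_some_slice)
  obtain e where e0: "e > 0"
    and min: "\<forall>q\<in>\<Omega>. q \<noteq> p \<and> dist q p < e \<longrightarrow> norm (f p) \<le> norm (f q)"
    using assms(4) unfolding eventually_at by blast
  have e: "norm (f p) \<le> norm (f q)" if "q \<in> \<Omega>" "dist q p < e" for q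
    using min that by (cases "q = p") auto
  obtain \<alpha> \<beta> d where d: "d > 0" "stem_on \<alpha> \<beta> (ball z0 d)"
    and rep: "\<And>z M. z \<in> ball z0 d \<Longrightarrow> M \<in> \<S> \<Longrightarrow> norm (M - J) < d \<Longrightarrow>
       emb M z \<in> \<Omega> \<and> f (emb M z) = \<alpha> z + M * \<beta> z"
    by (rule local_stem[OF sd reg J assms(3)[unfolded p]]) (rule that)
  \<comment> \<open>the stem of \<open>f\<close> normalized to have the value 1 at \<open>p\<close>\<close>
  define a where "a z = \<alpha> z * inverse (f p)" for z
  define b where "b z = \<beta> z * inverse (f p)" for z
  have ab: "a z + M * b z = f (emb M z) * inverse (f p)"
    if "z \<in> ball z0 d" "M \<in> \<S>" "norm (M - J) < d" for z M
    using rep[OF that] by (simp add: a_def b_def distrib_right mult.assoc)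
  have "continuous_on UNIV (\<lambda>x. emb (fst x) (snd x))"
    by (intro continuous_on_emb continuous_intros)
  then have "isCont (\<lambda>x. emb (fst x) (snd x)) (J, z0)"
    by (simp add: continuous_on_eq_continuous_at)
  then obtain e' where e': "e' > 0"
    "\<And>x. dist x (J, z0) < e' \<Longrightarrow> dist (emb (fst x) (snd x)) p < e"
    using e0 unfolding continuous_at_eps_delta p by fastforce
  define \<epsilon> where "\<epsilon> = min d (e' / 2)"
  have \<epsilon>: "\<epsilon> > 0" "\<epsilon> \<le> d" "\<epsilon> \<le> e' / 2" using d e' by (auto simp: \<epsilon>_def)
  obtain \<delta> where \<delta>: "\<delta> > 0" "\<delta> \<le> \<epsilon>" "\<And>z. z \<in> ball z0 \<delta> \<Longrightarrow> a z + J * b z = 1"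
  proof (rule stem_min_modulus[OF J \<epsilon>(1), of a b z0])
    show "stem_on a b (ball z0 \<epsilon>)"
      unfolding a_def b_def
      by (intro stem_on_bounded_linear[OF stem_on_subset[OF d(2)]] bounded_linear_mult_left)
        (use \<epsilon> in auto)
    show "a z0 + J * b z0 = 1" using ab[OF _ J, of z0] d fp by (simp flip: p)
    show "1 \<le> norm (a z + M * b z)" if "z \<in> ball z0 \<epsilon>" "M \<in> \<S>" "norm (M - J) < \<epsilon>" for z M
    proof -
      have "dist (M, z) (J, z0) \<le> dist M J + dist z z0"
        by (simp add: dist_Pair_Pair sqrt_sum_squares_le_sum)
      also have "\<dots> < e'" using that \<epsilon> by (simp add: dist_norm norm_minus_commute)
      finally have "dist (emb M z) p < e" using e'(2)[of "(M, z)"] by simp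
      moreover have zM: "z \<in> ball z0 d" "norm (M - J) < d" using that \<epsilon> by auto
      ultimately have "norm (f p) \<le> norm (f (emb M z))" using e rep[OF zM(1) that(2) zM(2)] by blast
      then show ?thesis
        unfolding ab[OF zM(1) that(2) zM(2)] norm_mult norm_inverse using fp
        by (simp add: field_simps)
    qed
  qed (use that in blast)
  have near: "f (emb J z) = f p" if "z \<in> ball z0 \<delta>" for z
  proof -
    have "f (emb J z) * inverse (f p) = 1" using \<delta> ab[OF _ J] that \<epsilon> d by force
    then have "f (emb J z) * inverse (f p) * f p = f p" by simp
    then show ?thesis using fp by (simp add: mult.assoc)
  qed
  have onJ: "f (emb J z) = f p" if "emb J z \<in> \<Omega>" for z
  proof (rule slice_hol_identity[OF J hol[OF J] open_emb_vimage[OF op] con[OF J]])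
    show "ball z0 \<delta> \<subseteq> {z. emb J z \<in> \<Omega>}" using rep[OF _ J] \<delta> \<epsilon> d by auto
    show "z0 islimpt ball z0 \<delta>" using \<delta> by (simp add: islimpt_ball)
  qed (use assms(3) p near that in auto)
  obtain r where r: "of_real r \<in> \<Omega>"
    using sd by (auto simp: slice_domain_def elim!: Reals_cases)
  have "f q = f p" if q: "q \<in> \<Omega>" for q
  proof -
    obtain M z where M: "M \<in> \<S>" and qz: "q = emb M z" by (rule quat_in_some_slice)
    have real: "f (of_real x) = f p" if "of_real x \<in> \<Omega>" for x
      using onJ[of "of_real x"] that by simp
    show ?thesis unfolding qz
      by (rule slice_hol_real_identity[OF M hol[OF M] open_emb_vimage[OF op] con[OF M], of r])
        (use r real q qz in auto)
  qed
  then show ?thesis by (auto simp: constant_on_def)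
qed simp

end
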